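(* Let $X$ be a treatment variable with $m$ values $x_1,\dots,x_m$ and $Y$ an effect variable with $n$ values $y_1,\dots,y_n$ in a structural causal model. Let $k\ge 2$, let $1\le i_1,\dots,i_k\le n$, and let $1\le j_1,\dots,j_k,p\le m$ be pairwise distinct. Put $S=\{(i_1,j_1),\dots,(i_k,j_k)\}$, $S_{-t}=S\setminus\{(i_t,j_t)\}$ and $S_t=\{(i_t,j_t)\}$. With the recursively defined quantities $L(\cdot),U(\cdot),L(\cdot\,;p),U(\cdot\,;p)$ of the context, the probability $P(Y_{x_{j_1}}=y_{i_1},\dots,Y_{x_{j_k}}=y_{i_k},X=x_p)$ is at least the maximum of the three quantities (1) $0$; (2) $\sum_{t=1}^{k}P(Y_{x_{j_t}}=y_{i_t})+P(X=x_p)-k$; (3) $\max_{1\le t\le k}\big(L(S_{-t})+L(S_t;p)-1\big)$; and at most the minimum of the four quantities (1') $\min_{1\le t\le k}P(Y_{x_{j_t}}=y_{i_t})$; (2') $P(X=x_p)$; (3') $\min_{1\le t\le k}U(S_{-t})$; (4') $\min_{1\le t\le k}U(S_t;p)$.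
   Context: Setting. $Y_{x_j}$ denotes the counterfactual (potential outcome) variable "the value $Y$ would have, had $X$ been $x_j$". The structural causal model induces one probability space $P$ on which $X$, $Y$, and $Y_{x_1},\dots,Y_{x_m}$ (each with values in $\{y_1,\dots,y_n\}$) are jointly defined, and they satisfy consistency: on the event $X=x_j$ one has $Y_{x_j}=Y$. The values $x_1,\dots,x_m$ are distinct, as are $y_1,\dots,y_n$. Recursive bounds. Throughout, $S=\{(i_1,j_1),\dots,(i_k,j_k)\}$ with $k\ge1$, $1\le i_t\le n$, $1\le j_t\le m$ and $j_1,\dots,j_k$ pairwise distinct; $J=\{j_1,\dots,j_k\}$; $S_{-t}=S\setminus\{(i_t,j_t)\}$; $S_t=\{(i_t,j_t)\}$; $1\le p\le m$ with $p\notin J$; $1\le q\le n$. Write $a_t=P(Y_{x_{j_t}}=y_{i_t})$, and write $P(x_p)$ for $P(X=x_p)$ and $P(x_p,y_q)$ for $P(X=x_p,Y=y_q)$. $L(S),U(S)$ are the lower and upper bounds used for $P(Y_{x_{j_1}}=y_{i_1},\dots,Y_{x_{j_k}}=y_{i_k})$; $L(S;p),U(S;p)$ those used for $P(Y_{x_{j_1}}=y_{i_1},\dots,Y_{x_{j_k}}=y_{i_k},X=x_p)$; $L(S;p,q),U(S;p,q)$ those used for $P(Y_{x_{j_1}}=y_{i_1},\dots,Y_{x_{j_k}}=y_{i_k},X=x_p,Y=y_q)$. They are the following numbers, defined by recursion on $k$. Case $k=1$, $S=\{(i,j)\}$, $a=P(Y_{x_j}=y_i)$: $L(S)=U(S)=a$;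 $L(S;p)=\max\{0,\ a-P(x_j,y_i)-1+P(x_j)+P(x_p)\}$; $U(S;p)=\min\{a-P(x_j,y_i),\ P(x_p)\}$; $L(S;p,q)=\max\{0,\ a+P(x_p,y_q)-1+P(x_j)-P(x_j,y_i)\}$; $U(S;p,q)=\min\{a-P(x_j,y_i),\ P(x_p,y_q)\}$. Case $k\ge2$: $L(S;p)=\max\{0,\ \sum_{t}a_t+P(x_p)-k,\ \max_{t}(L(S_{-t})+L(S_t;p)-1)\}$; $U(S;p)=\min\{\min_t a_t,\ P(x_p),\ \min_t U(S_{-t}),\ \min_t U(S_t;p)\}$; $L(S;p,q)=\max\{0,\ \sum_{t}a_t+P(x_p,y_q)-k,\ \max_{t}(L(S_{-t})+L(S_t;p,q)-1)\}$; $U(S;p,q)=\min\{\min_t a_t,\ P(x_p,y_q),\ \min_t U(S_{-t}),\ \min_t U(S_t;p,q)\}$; $L(S)=\max\{0,\ \sum_t a_t-k+1,\ \max_t(L(S_{-t})+a_t-1),\ \sum_{r=1}^kL(S_{-r};j_r,i_r)+\sum_{p\notin J}L(S;p)\}$; $U(S)=\min\{\min_t a_t,\ \min_tU(S_{-t}),\ \sum_{r=1}^kU(S_{-r};j_r,i_r)+\sum_{p\notin J}U(S;p)\}$, where $t$ ranges over $1,\dots,k$ and $p\notin J$ means $p\in\{1,\dots,m\}\setminus J$. *)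

theory Defs
  imports "HOL-Probability.Probability"
begin

text \<open>
  The random variables that a structural causal model with treatment \<open>X\<close> and effect \<open>Y\<close> induces
  on one common sample space. The sample space is \<open>law C\<close>, and \<open>outcome C v\<close> is the counterfactual
  \<open>Y\<^sub>v\<close>, the value that \<open>Y\<close> would have had, had \<open>X\<close> been \<open>v\<close>. The values of \<open>X\<close> are
  \<open>xval C 1, \<dots>, xval C (xnum C)\<close>, and likewise for \<open>Y\<close>. The structural equations themselves are
  not recorded: their only consequence in use is \<open>consistency\<close> below.
\<close>

record ('w, 'x, 'y) causal_model =
  law :: "'w measure"
  treatment :: "'w \<Rightarrow> 'x"
  effect :: "'w \<Rightarrow> 'y"
  outcome :: "'x \<Rightarrow> 'w \<Rightarrow> 'y"
  xnum :: nat
  xval :: "nat \<Rightarrow> 'x"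
  ynum :: nat
  yval :: "nat \<Rightarrow> 'y"

locale causal_model = prob_space "law C"
  for C :: "('w, 'x, 'y) causal_model" +
  assumes xval_inj: "inj_on (xval C) {1..xnum C}"
    and yval_inj: "inj_on (yval C) {1..ynum C}"
    and treatment_rv: "random_variable (count_space (xval C ` {1..xnum C})) (treatment C)"
    and effect_rv: "random_variable (count_space (yval C ` {1..ynum C})) (effect C)"
    and outcome_rv: "\<And>j. j \<in> {1..xnum C} \<Longrightarrow>
      random_variable (count_space (yval C ` {1..ynum C})) (outcome C (xval C j))"
    and consistency: "\<And>j \<omega>. j \<in> {1..xnum C} \<Longrightarrow> \<omega> \<in> space (law C) \<Longrightarrow>
      treatment C \<omega> = xval C j \<Longrightarrow> outcome C (xval C j) \<omega> = effect C \<omega>"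

text \<open>
  \<open>P_X C p\<close> is \<open>P(X = x\<^sub>p)\<close>, \<open>P_XY C p q\<close> is \<open>P(X = x\<^sub>p, Y = y\<^sub>q)\<close>, and for a pair \<open>t = (i, j)\<close>,
  \<open>P_out C t\<close> is the probability that \<open>Y\<close> would be \<open>y\<^sub>i\<close>, had \<open>X\<close> been \<open>x\<^sub>j\<close>.
\<close>

definition P_X :: "('w, 'x, 'y) causal_model \<Rightarrow> nat \<Rightarrow> real" where
  "P_X C p = \<P>(\<omega> in law C. treatment C \<omega> = xval C p)"

definition P_XY :: "('w, 'x, 'y) causal_model \<Rightarrow> nat \<Rightarrow> nat \<Rightarrow> real" where
  "P_XY C p q = \<P>(\<omega> in law C. treatment C \<omega> = xval C p \<and> effect C \<omega> = yval C q)"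

definition P_out :: "('w, 'x, 'y) causal_model \<Rightarrow> nat \<times> nat \<Rightarrow> real" where
  "P_out C t = \<P>(\<omega> in law C. outcome C (xval C (snd t)) \<omega> = yval C (fst t))"

text \<open>
  \<open>L C S\<close>, \<open>L_X C S p\<close> and \<open>L_XY C S p q\<close> are the lower bounds \<open>L(S)\<close>, \<open>L(S;p)\<close> and \<open>L(S;p,q)\<close>;
  similarly for the upper bounds \<open>U\<close>. They are meant for finite nonempty sets \<open>S\<close> of pairs \<open>(i, j)\<close>
  whose second components are pairwise distinct and different from \<open>p\<close>; values at other
  arguments are immaterial. Note that the \<open>r\<close>-th summand in the recursion for \<open>L(S)\<close> has \<open>p = j\<^sub>r\<close>
  and \<open>q = i\<^sub>r\<close>, in swapped order compared to the pair \<open>(i\<^sub>r, j\<^sub>r)\<close>.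
\<close>

function
  L :: "('w, 'x, 'y) causal_model \<Rightarrow> (nat \<times> nat) set \<Rightarrow> real" and
  L_X :: "('w, 'x, 'y) causal_model \<Rightarrow> (nat \<times> nat) set \<Rightarrow> nat \<Rightarrow> real" and
  L_XY :: "('w, 'x, 'y) causal_model \<Rightarrow> (nat \<times> nat) set \<Rightarrow> nat \<Rightarrow> nat \<Rightarrow> real"
where
  "L C S =
    (if card S < 2 then P_out C (the_elem S)
     else Max {0,
       (\<Sum>t\<in>S. P_out C t) - real (card S) + 1,
       (MAX t\<in>S. L C (S - {t}) + P_out C t - 1),
       (\<Sum>r\<in>S. L_XY C (S - {r}) (snd r) (fst r)) + (\<Sum>p\<in>{1..xnum C} - snd ` S. L_X C S p)})"
| "L_X C S p =
    (if card S < 2 then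
       let (i, j) = the_elem S in
       max 0 (P_out C (i, j) - P_XY C j i - 1 + P_X C j + P_X C p)
     else Max {0,
       (\<Sum>t\<in>S. P_out C t) + P_X C p - real (card S),
       (MAX t\<in>S. L C (S - {t}) + L_X C {t} p - 1)})"
| "L_XY C S p q =
    (if card S < 2 then
       let (i, j) = the_elem S in
       max 0 (P_out C (i, j) + P_XY C p q - 1 + P_X C j - P_XY C j i)
     else Max {0,
       (\<Sum>t\<in>S. P_out C t) + P_XY C p q - real (card S),
       (MAX t\<in>S. L C (S - {t}) + L_XY C {t} p q - 1)})"
  by pat_completeness auto
termination
  by (relation "Wellfounded.measure (\<lambda>a. case a of Inl (C, S) \<Rightarrow> 2 * card S + 1
        | Inr (Inl (C, S, p)) \<Rightarrow> 2 * card S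
        | Inr (Inr (C, S, p, q)) \<Rightarrow> 2 * card S)")
    (auto simp: card_Diff_singleton_if)

function
  U :: "('w, 'x, 'y) causal_model \<Rightarrow> (nat \<times> nat) set \<Rightarrow> real" and
  U_X :: "('w, 'x, 'y) causal_model \<Rightarrow> (nat \<times> nat) set \<Rightarrow> nat \<Rightarrow> real" and
  U_XY :: "('w, 'x, 'y) causal_model \<Rightarrow> (nat \<times> nat) set \<Rightarrow> nat \<Rightarrow> nat \<Rightarrow> real"
where
  "U C S =
    (if card S < 2 then P_out C (the_elem S)
     else Min {
       (MIN t\<in>S. P_out C t),
       (MIN t\<in>S. U C (S - {t})),
       (\<Sum>r\<in>S. U_XY C (S - {r}) (snd r) (fst r)) + (\<Sum>p\<in>{1..xnum C} - snd ` S. U_X C S p)})"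
| "U_X C S p =
    (if card S < 2 then
       let (i, j) = the_elem S in min (P_out C (i, j) - P_XY C j i) (P_X C p)
     else Min {
       (MIN t\<in>S. P_out C t),
       P_X C p,
       (MIN t\<in>S. U C (S - {t})),
       (MIN t\<in>S. U_X C {t} p)})"
| "U_XY C S p q =
    (if card S < 2 then
       let (i, j) = the_elem S in min (P_out C (i, j) - P_XY C j i) (P_XY C p q)
     else Min {
       (MIN t\<in>S. P_out C t),
       P_XY C p q,
       (MIN t\<in>S. U C (S - {t})),
       (MIN t\<in>S. U_XY C {t} p q)})"
  by pat_completeness auto
termination
  by (relation "Wellfounded.measure (\<lambda>a. case a of Inl (C, S) \<Rightarrow> 2 * card S + 1
        | Inr (Inl (C, S, p)) \<Rightarrow> 2 * card S
        | Inr (Inr (C, S, p, q)) \<Rightarrow> 2 * card S)")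
    (auto simp: card_Diff_singleton_if)

declare L.simps [simp del] L_X.simps [simp del] L_XY.simps [simp del]
declare U.simps [simp del] U_X.simps [simp del] U_XY.simps [simp del]

end

theory Submission
  imports Defs
begin

text \<open>
  Each bound on a joint event is an instance of \<open>P(A \<inter> B) \<ge> P(A) + P(B) - 1\<close> or of monotonicity.
  Consistency enters twice. First, an event \<open>Y\<^sub>x\<^sub>j = y\<^sub>i\<close> meets \<open>X = x\<^sub>j\<close> exactly in
  \<open>X = x\<^sub>j, Y = y\<^sub>i\<close>, so that its part disjoint from \<open>X = x\<^sub>j\<close> has probability
  \<open>P(Y\<^sub>x\<^sub>j = y\<^sub>i) - P(x\<^sub>j, y\<^sub>i)\<close>; this gives the case \<open>k = 1\<close>. Secondly, when the joint event of \<open>S\<close>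
  is split according to the value of \<open>X\<close>, on \<open>X = x\<^sub>j\<^sub>r\<close> the \<open>r\<close>-th condition can be replaced by
  \<open>Y = y\<^sub>i\<^sub>r\<close>; this gives the recursion for \<open>L(S)\<close> and \<open>U(S)\<close>.
\<close>

context causal_model
begin

section \<open>Events and their measurability\<close>

definition outcome_event :: "(nat \<times> nat) set \<Rightarrow> 'w set" where
  "outcome_event S = {\<omega> \<in> space (law C). \<forall>t\<in>S. outcome C (xval C (snd t)) \<omega> = yval C (fst t)}"

definition treatment_event :: "nat \<Rightarrow> 'w set" where
  "treatment_event p = {\<omega> \<in> space (law C). treatment C \<omega> = xval C p}"

definition observed_event :: "nat \<Rightarrow> nat \<Rightarrow> 'w set" where
  "observed_event p q = {\<omega> \<in> space (law C). treatment C \<omega> = xval C p \<and> effect C \<omega> = yval C q}"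

text \<open>Set form of a family of k >= 1 conditions: injectivity of \<open>snd\<close> says that
  the treatment indices are pairwise distinct. The empty set is excluded because \<open>L\<close>
  and \<open>U\<close> fall back on \<open>the_elem {}\<close> there, an unspecified pair.\<close>

definition admissible :: "(nat \<times> nat) set \<Rightarrow> bool" where
  "admissible S \<longleftrightarrow> S \<noteq> {} \<and> S \<subseteq> {1..ynum C} \<times> {1..xnum C} \<and> inj_on snd S"

lemma P_out_eq: "P_out C t = prob (outcome_event {t})"
  by (simp add: P_out_def outcome_event_def)

lemma P_X_eq: "P_X C p = prob (treatment_event p)"
  by (simp add: P_X_def treatment_event_def)

lemma P_XY_eq: "P_XY C p q = prob (observed_event p q)"
  by (simp add: P_XY_def observed_event_def)

lemma admissible_finite: "admissible S \<Longrightarrow> finite S"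
  unfolding admissible_def by (meson finite_SigmaI finite_atLeastAtMost finite_subset)

lemma admissible_subset: "admissible S \<Longrightarrow> T \<subseteq> S \<Longrightarrow> T \<noteq> {} \<Longrightarrow> admissible T"
  unfolding admissible_def by (meson inj_on_subset subset_trans)

lemma admissible_remove:
  assumes "admissible S" "card S \<ge> 2"
  shows "admissible (S - {t})"
proof (rule admissible_subset[OF assms(1)])
  show "S - {t} \<noteq> {}"
    using assms(2) card_mono[of "{t}" S] by auto
qed auto

lemma treatment_event_sets:
  assumes "p \<in> {1..xnum C}"
  shows "treatment_event p \<in> events"
proof -
  have "treatment C -` {xval C p} \<inter> space (law C) \<in> events"
    using assms by (intro measurable_sets[OF treatment_rv]) auto
  moreover have "treatment_event p = treatment C -` {xval C p} \<inter> space (law C)"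
    by (auto simp: treatment_event_def)
  ultimately show ?thesis by simp
qed

lemma observed_event_sets:
  assumes "p \<in> {1..xnum C}" "q \<in> {1..ynum C}"
  shows "observed_event p q \<in> events"
proof -
  have "effect C -` {yval C q} \<inter> space (law C) \<in> events"
    using assms by (intro measurable_sets[OF effect_rv]) auto
  moreover have "observed_event p q =
      treatment_event p \<inter> (effect C -` {yval C q} \<inter> space (law C))"
    by (auto simp: observed_event_def treatment_event_def)
  ultimately show ?thesis using treatment_event_sets[OF assms(1)] by auto
qed

lemma outcome_event_insert: "outcome_event (insert t S) = outcome_event {t} \<inter> outcome_event S"
  by (auto simp: outcome_event_def)

lemma outcome_event_sets:
  assumes "finite S" "S \<subseteq> {1..ynum C} \<times> {1..xnum C}"
  shows "outcome_event S \<in> events"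
  using assms
proof (induction S)
  case empty
  then show ?case by (simp add: outcome_event_def)
next
  case (insert t S)
  have "outcome C (xval C (snd t)) -` {yval C (fst t)} \<inter> space (law C) \<in> events"
    using insert.prems by (intro measurable_sets[OF outcome_rv]) auto
  moreover have "outcome_event {t} =
      outcome C (xval C (snd t)) -` {yval C (fst t)} \<inter> space (law C)"
    by (auto simp: outcome_event_def)
  ultimately show ?case using insert by (subst outcome_event_insert) auto
qed

lemma admissible_sets: "admissible S \<Longrightarrow> outcome_event S \<in> events"
  by (simp add: outcome_event_sets admissible_finite admissible_def)

lemma admissible_sets_singleton: "admissible S \<Longrightarrow> t \<in> S \<Longrightarrow> outcome_event {t} \<in> events"
  by (rule admissible_sets, rule admissible_subset[of S]) auto

section \<open>Inequalities and identities for joint events\<close>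

lemma prob_Int_ge:
  assumes "A \<in> events" "B \<in> events"
  shows "prob A + prob B - 1 \<le> prob (A \<inter> B)"
  \<comment> \<open>Inclusion-exclusion, with the probability of the union bounded by 1.\<close>
  using finite_measure_Union'[OF assms] finite_measure_Diff'[OF assms(2,1)] prob_le_1[of "A \<union> B"]
  by (simp add: Int_commute)

text \<open>Peeling off one condition at a time costs 1 by \<open>prob_Int_ge\<close>, hence
  \<open>card S\<close> in total. Carrying \<open>A\<close> along lets the induction start from
  \<open>A\<close> itself.\<close>

lemma prob_outcome_event_Int_ge:
  assumes "finite S" "S \<subseteq> {1..ynum C} \<times> {1..xnum C}" "A \<in> events"
  shows "(\<Sum>t\<in>S. P_out C t) + prob A - real (card S) \<le> prob (outcome_event S \<inter> A)"
  using assms(1,2)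
proof (induction S)
  case empty
  have "outcome_event {} \<inter> A = A"
    using sets.sets_into_space[OF assms(3)] by (auto simp: outcome_event_def)
  then show ?case by simp
next
  case (insert t S)
  have "prob (outcome_event {t}) + prob (outcome_event S \<inter> A) - 1
      \<le> prob (outcome_event {t} \<inter> (outcome_event S \<inter> A))"
    using insert assms(3) by (intro prob_Int_ge sets.Int outcome_event_sets) auto
  moreover have "outcome_event {t} \<inter> (outcome_event S \<inter> A) = outcome_event (insert t S) \<inter> A"
    by (subst (2) outcome_event_insert) auto
  ultimately show ?case
    using insert by (simp add: P_out_eq)
qed

lemma treatment_event_disjoint:
  assumes "p \<in> {1..xnum C}" "p' \<in> {1..xnum C}" "p \<noteq> p'"
  shows "treatment_event p \<inter> treatment_event p' = {}"
  using inj_onD[OF xval_inj, of p p'] assms by (auto simp: treatment_event_def)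

text \<open>This exact splitting has the shape of the last entry in the recursions for
  \<open>L C S\<close> and \<open>U C S\<close>, so that entry is a valid bound as soon as each
  summand is bounded.\<close>

lemma prob_outcome_event_eq_sum:
  assumes "admissible S"
  shows "prob (outcome_event S) =
    (\<Sum>r\<in>S. prob (outcome_event (S - {r}) \<inter> observed_event (snd r) (fst r)))
    + (\<Sum>p\<in>{1..xnum C} - snd ` S. prob (outcome_event S \<inter> treatment_event p))"
proof -
  let ?f = "\<lambda>p. prob (outcome_event S \<inter> treatment_event p)"
  have sub: "S \<subseteq> {1..ynum C} \<times> {1..xnum C}" and inj: "inj_on snd S"
    using assms by (auto simp: admissible_def)
  \<comment> \<open>By \<open>treatment_rv\<close> the treatment takes only the listed values, so
    the treatment events cover the sample space.\<close>
  have "outcome_event S = (\<Union>p\<in>{1..xnum C}. outcome_event S \<inter> treatment_event p)"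
    using measurable_space[OF treatment_rv]
    by (auto simp: outcome_event_def treatment_event_def)
  also have "prob \<dots> = (\<Sum>p\<in>{1..xnum C}. ?f p)"
  proof (rule finite_measure_finite_Union)
    show "disjoint_family_on (\<lambda>p. outcome_event S \<inter> treatment_event p) {1..xnum C}"
      unfolding disjoint_family_on_def using treatment_event_disjoint by blast
  qed (use admissible_sets[OF assms] treatment_event_sets in auto)
  also have "\<dots> = (\<Sum>p\<in>snd ` S. ?f p) + (\<Sum>p\<in>{1..xnum C} - snd ` S. ?f p)"
    using sub by (subst sum.subset_diff[of "snd ` S"]) auto
  also have "(\<Sum>p\<in>snd ` S. ?f p) = (\<Sum>r\<in>S. ?f (snd r))"
    using inj by (simp add: sum.reindex)
  also have "\<dots> = (\<Sum>r\<in>S. prob (outcome_event (S - {r}) \<inter> observed_event (snd r) (fst r)))"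
  proof (rule sum.cong[OF refl])
    fix r assume r: "r \<in> S"
    then have j: "snd r \<in> {1..xnum C}" using sub by auto
    have "outcome_event S \<inter> treatment_event (snd r)
        = outcome_event (S - {r}) \<inter> observed_event (snd r) (fst r)"
      unfolding outcome_event_def treatment_event_def observed_event_def
      using r consistency[OF j] by auto
    then show "?f (snd r) = prob (outcome_event (S - {r}) \<inter> observed_event (snd r) (fst r))"
      by simp
  qed
  finally show ?thesis .
qed

text \<open>Since \<open>A\<close> misses X = x_j, it meets the outcome event only in the part
  outside X = x_j. Leaving \<open>A\<close> abstract serves both X = x_p and X = x_p, Y = y_q with p
  different from j.\<close>

lemma single_bounds:
  assumes t: "(i, j) \<in> {1..ynum C} \<times> {1..xnum C}"
    and A: "A \<in> events" "A \<inter> treatment_event j = {}"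
  shows "P_out C (i, j) - P_XY C j i - 1 + P_X C j + prob A \<le> prob (outcome_event {(i, j)} \<inter> A)"
    and "prob (outcome_event {(i, j)} \<inter> A) \<le> P_out C (i, j) - P_XY C j i"
proof -
  let ?E = "outcome_event {(i, j)}" and ?T = "treatment_event j"
  have E: "?E \<in> events" and T: "?T \<in> events"
    using t by (auto intro: outcome_event_sets treatment_event_sets)
  have "?E \<inter> ?T = observed_event j i"
    using t consistency[of j]
    by (auto simp: outcome_event_def treatment_event_def observed_event_def)
  then have eq: "prob (?E - ?T) = P_out C (i, j) - P_XY C j i"
    using finite_measure_Diff'[OF E T] by (simp add: P_out_eq P_XY_eq)
  have "prob (?E \<inter> A) \<le> prob (?E - ?T)"
    using A E T by (intro finite_measure_mono) auto
  then show "prob (?E \<inter> A) \<le> P_out C (i, j) - P_XY C j i"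
    using eq by simp
  \<comment> \<open>Enlarging \<open>A\<close> by \<open>?T\<close> does not change the intersection
    with \<open>?E - ?T\<close>, but raises the probability by \<open>P_X C j\<close>. This is the
    source of the term \<open>P_X C j\<close> in the bound.\<close>
  have "prob (?E - ?T) + prob (A \<union> ?T) - 1 \<le> prob ((?E - ?T) \<inter> (A \<union> ?T))"
    using A E T by (intro prob_Int_ge) auto
  also have "(?E - ?T) \<inter> (A \<union> ?T) = ?E \<inter> A"
    using A(2) by auto
  also have "prob (A \<union> ?T) = prob A + P_X C j"
    using A T by (simp add: finite_measure_Union P_X_eq)
  finally show "P_out C (i, j) - P_XY C j i - 1 + P_X C j + prob A \<le> prob (?E \<inter> A)"
    using eq by simp
qed

text \<open>With \<open>A\<close>, \<open>l\<close> and \<open>l1\<close> abstract, one argument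
  serves three recursions: \<open>A\<close> will be a treatment event, an observed event, or the
  whole space. The last entry comes from splitting the joint event into
  \<open>outcome_event (S - {t})\<close>, bounded by \<open>l\<close>, and
  \<open>outcome_event {t} \<inter> A\<close>, bounded by \<open>l1\<close>.\<close>

lemma joint_lower_bound:
  assumes S: "admissible S" "card S \<ge> 2" and A: "A \<in> events"
    and l: "\<And>t. t \<in> S \<Longrightarrow> l (S - {t}) \<le> prob (outcome_event (S - {t}))"
    and lA: "\<And>t. t \<in> S \<Longrightarrow> l1 {t} \<le> prob (outcome_event {t} \<inter> A)"
  shows "Max {0, (\<Sum>t\<in>S. P_out C t) + prob A - real (card S),
      (MAX t\<in>S. l (S - {t}) + l1 {t} - 1)} \<le> prob (outcome_event S \<inter> A)"
proof -
  have sub: "S \<subseteq> {1..ynum C} \<times> {1..xnum C}" and ne: "S \<noteq> {}"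
    using S by (auto simp: admissible_def)
  have "l (S - {t}) + l1 {t} - 1 \<le> prob (outcome_event S \<inter> A)" if "t \<in> S" for t
  proof -
    have "prob (outcome_event (S - {t})) + prob (outcome_event {t} \<inter> A) - 1
        \<le> prob (outcome_event (S - {t}) \<inter> (outcome_event {t} \<inter> A))"
      using that A S
      by (intro prob_Int_ge sets.Int admissible_sets_singleton[OF S(1)]
          admissible_sets[OF admissible_remove])
    also have "outcome_event (S - {t}) \<inter> (outcome_event {t} \<inter> A) = outcome_event S \<inter> A"
      using outcome_event_insert[of t "S - {t}"] insert_Diff[OF that] by auto
    finally show ?thesis using l lA that by fastforce
  qed
  then show ?thesis
    using ne prob_outcome_event_Int_ge[OF admissible_finite[OF S(1)] sub A]
    by (simp add: admissible_finite[OF S(1)])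
qed

text \<open>Each entry is the probability of an event containing the joint event, or an upper bound
  for such a probability.\<close>

lemma joint_upper_bound:
  assumes S: "admissible S" "card S \<ge> 2" and A: "A \<in> events"
    and u: "\<And>t. t \<in> S \<Longrightarrow> prob (outcome_event (S - {t})) \<le> u (S - {t})"
    and uA: "\<And>t. t \<in> S \<Longrightarrow> prob (outcome_event {t} \<inter> A) \<le> u1 {t}"
  shows "prob (outcome_event S \<inter> A) \<le> Min {MIN t\<in>S. P_out C t, prob A,
      MIN t\<in>S. u (S - {t}), MIN t\<in>S. u1 {t}}"
proof -
  have ne: "S \<noteq> {}"
    using S by (auto simp: admissible_def)
  have "prob (outcome_event S \<inter> A) \<le> P_out C t
      \<and> prob (outcome_event S \<inter> A) \<le> u (S - {t}) \<and> prob (outcome_event S \<inter> A) \<le> u1 {t}"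
    if "t \<in> S" for t
  proof -
    have ev: "outcome_event {t} \<in> events" "outcome_event (S - {t}) \<in> events"
      using that admissible_sets_singleton[OF S(1)] admissible_sets[OF admissible_remove[OF S]]
      by simp_all
    have "outcome_event S \<inter> A \<subseteq> outcome_event {t}"
      "outcome_event S \<inter> A \<subseteq> outcome_event (S - {t})"
      "outcome_event S \<inter> A \<subseteq> outcome_event {t} \<inter> A"
      using that by (auto simp: outcome_event_def)
    from this[THEN finite_measure_mono] show ?thesis
      using u[OF that] uA[OF that] ev A by (fastforce simp: P_out_eq)
  qed
  moreover have "prob (outcome_event S \<inter> A) \<le> prob A"
    using A by (intro finite_measure_mono) auto
  ultimately show ?thesis
    using ne by (simp add: admissible_finite[OF S(1)])
qed

section \<open>Validity of the recursive bounds\<close>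

lemma treatment_bounds_single:
  assumes "(i, j) \<in> {1..ynum C} \<times> {1..xnum C}" "p \<in> {1..xnum C}" "p \<noteq> j"
  shows "L_X C {(i, j)} p \<le> prob (outcome_event {(i, j)} \<inter> treatment_event p)"
    and "prob (outcome_event {(i, j)} \<inter> treatment_event p) \<le> U_X C {(i, j)} p"
  using single_bounds[OF assms(1) treatment_event_sets[OF assms(2)]] assms
    treatment_event_disjoint[of p j] finite_measure_mono[of _ "treatment_event p"]
    treatment_event_sets[of p]
  by (simp_all add: L_X.simps U_X.simps P_X_eq)

lemma observed_bounds_single:
  assumes "(i, j) \<in> {1..ynum C} \<times> {1..xnum C}" "p \<in> {1..xnum C}" "q \<in> {1..ynum C}" "p \<noteq> j"
  shows "L_XY C {(i, j)} p q \<le> prob (outcome_event {(i, j)} \<inter> observed_event p q)"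
    and "prob (outcome_event {(i, j)} \<inter> observed_event p q) \<le> U_XY C {(i, j)} p q"
proof -
  have "observed_event p q \<inter> treatment_event j = {}"
    using treatment_event_disjoint[of p j] assms
    by (auto simp: observed_event_def treatment_event_def)
  note b = single_bounds[OF assms(1) observed_event_sets[OF assms(2,3)] this]
  show "L_XY C {(i, j)} p q \<le> prob (outcome_event {(i, j)} \<inter> observed_event p q)"
    using b by (simp add: L_XY.simps P_XY_eq)
  show "prob (outcome_event {(i, j)} \<inter> observed_event p q) \<le> U_XY C {(i, j)} p q"
    using b finite_measure_mono[of _ "observed_event p q"] observed_event_sets[OF assms(2,3)]
    by (simp add: U_XY.simps P_XY_eq)
qed

text \<open>\<open>L C S\<close> refers to \<open>L_X C S\<close>, which refers back to
  \<open>L\<close> at smaller sets. Assuming the bounds at those smaller sets makes the lemma usable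
  inside the induction for \<open>outcome_bounds\<close>. The guard \<open>card S \<ge> 2\<close>
  keeps \<open>S - {t}\<close> nonempty.\<close>

lemma treatment_bounds_step:
  assumes S: "admissible S" and p: "p \<in> {1..xnum C} - snd ` S"
    and IH: "\<And>t. \<lbrakk>card S \<ge> 2; t \<in> S\<rbrakk> \<Longrightarrow>
      L C (S - {t}) \<le> prob (outcome_event (S - {t})) \<and>
      prob (outcome_event (S - {t})) \<le> U C (S - {t})"
  shows "L_X C S p \<le> prob (outcome_event S \<inter> treatment_event p) \<and>
    prob (outcome_event S \<inter> treatment_event p) \<le> U_X C S p"
proof -
  have sub: "S \<subseteq> {1..ynum C} \<times> {1..xnum C}"
    using S by (auto simp: admissible_def)
  have single: "L_X C {t} p \<le> prob (outcome_event {t} \<inter> treatment_event p) \<and>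
      prob (outcome_event {t} \<inter> treatment_event p) \<le> U_X C {t} p" if "t \<in> S" for t
    using treatment_bounds_single[of "fst t" "snd t" p] that sub p by auto
  show ?thesis
  proof (cases "card S \<ge> 2")
    case True
    \<comment> \<open>The recursion equation is instantiated at \<open>S\<close>, so that the bounds
      \<open>L_X C {t} p\<close> on its right-hand side stay folded and match
      \<open>single\<close>.\<close>
    have "L_X C S p \<le> prob (outcome_event S \<inter> treatment_event p)"
      using joint_lower_bound[OF S True treatment_event_sets, of p "L C" "\<lambda>T. L_X C T p"]
        IH[OF True] single p True
      by (simp add: L_X.simps[of C S] P_X_eq)
    moreover have "prob (outcome_event S \<inter> treatment_event p) \<le> U_X C S p"
      using joint_upper_bound[OF S True treatment_event_sets, of p "U C" "\<lambda>T. U_X C T p"]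
        IH[OF True] single p True
      by (simp add: U_X.simps[of C S] P_X_eq)
    ultimately show ?thesis ..
  next
    case False
    then have "card S = 1"
      using S admissible_finite[OF S] card_gt_0_iff[of S] unfolding admissible_def by linarith
    then obtain t where "S = {t}" by (auto simp: card_1_singleton_iff)
    then show ?thesis using single by auto
  qed
qed

text \<open>The same scheme with an observed event for \<open>A\<close>. The induction applies it to
  \<open>S - {r}\<close> with \<open>p = snd r\<close> and \<open>q = fst r\<close>.\<close>

lemma observed_bounds_step:
  assumes S: "admissible S" and p: "p \<in> {1..xnum C} - snd ` S" and q: "q \<in> {1..ynum C}"
    and IH: "\<And>t. \<lbrakk>card S \<ge> 2; t \<in> S\<rbrakk> \<Longrightarrow>
      L C (S - {t}) \<le> prob (outcome_event (S - {t})) \<and>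
      prob (outcome_event (S - {t})) \<le> U C (S - {t})"
  shows "L_XY C S p q \<le> prob (outcome_event S \<inter> observed_event p q) \<and>
    prob (outcome_event S \<inter> observed_event p q) \<le> U_XY C S p q"
proof -
  have sub: "S \<subseteq> {1..ynum C} \<times> {1..xnum C}"
    using S by (auto simp: admissible_def)
  have single: "L_XY C {t} p q \<le> prob (outcome_event {t} \<inter> observed_event p q) \<and>
      prob (outcome_event {t} \<inter> observed_event p q) \<le> U_XY C {t} p q" if "t \<in> S" for t
    using observed_bounds_single[of "fst t" "snd t" p q] that sub p q by auto
  show ?thesis
  proof (cases "card S \<ge> 2")
    case True
    have "L_XY C S p q \<le> prob (outcome_event S \<inter> observed_event p q)"
      using joint_lower_bound[OF S True observed_event_sets, of p q "L C" "\<lambda>T. L_XY C T p q"]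
        IH[OF True] single p q True
      by (simp add: L_XY.simps[of C S] P_XY_eq)
    moreover have "prob (outcome_event S \<inter> observed_event p q) \<le> U_XY C S p q"
      using joint_upper_bound[OF S True observed_event_sets, of p q "U C" "\<lambda>T. U_XY C T p q"]
        IH[OF True] single p q True
      by (simp add: U_XY.simps[of C S] P_XY_eq)
    ultimately show ?thesis ..
  next
    case False
    then have "card S = 1"
      using S admissible_finite[OF S] card_gt_0_iff[of S] unfolding admissible_def by linarith
    then obtain t where "S = {t}" by (auto simp: card_1_singleton_iff)
    then show ?thesis using single by auto
  qed
qed

text \<open>Strong induction on the number of conditions: unfolding \<open>L C S\<close> reaches
  \<open>L\<close> at \<open>S\<close> without one pair, directly and through
  \<open>L_X C S\<close>, and at \<open>S\<close> without two pairs through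
  \<open>L_XY C (S - {r})\<close>. The pattern for \<open>U\<close> is the same.\<close>

lemma outcome_bounds:
  assumes "admissible S"
  shows "L C S \<le> prob (outcome_event S) \<and> prob (outcome_event S) \<le> U C S"
  using assms
proof (induction "card S" arbitrary: S rule: less_induct)
  case less
  note S = less.prems
  have fin: "finite S" by (rule admissible_finite[OF S])
  have sub: "S \<subseteq> {1..ynum C} \<times> {1..xnum C}" and ne: "S \<noteq> {}" and inj: "inj_on snd S"
    using S by (auto simp: admissible_def)
  show ?case
  proof (cases "card S \<ge> 2")
    case False
    then have "card S = 1"
      using fin ne card_gt_0_iff[of S] by linarith
    then obtain t where "S = {t}" by (auto simp: card_1_singleton_iff)
    then show ?thesis by (simp add: L.simps U.simps P_out_eq)
  next
    case True
    have IH: "L C T \<le> prob (outcome_event T) \<and> prob (outcome_event T) \<le> U C T"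
      if "T \<subset> S" "T \<noteq> {}" for T
      using that less.hyps[of T] psubset_card_mono[OF fin] admissible_subset[OF S, of T] by blast
    have IH1: "L C (S - {t}) \<le> prob (outcome_event (S - {t})) \<and>
        prob (outcome_event (S - {t})) \<le> U C (S - {t})" if "t \<in> S" for t
      using that admissible_remove[OF S True, of t]
      by (intro IH) (auto simp: admissible_def)
    have X: "L_X C S p \<le> prob (outcome_event S \<inter> treatment_event p) \<and>
        prob (outcome_event S \<inter> treatment_event p) \<le> U_X C S p"
      if "p \<in> {1..xnum C} - snd ` S" for p
      using S that IH1 by (rule treatment_bounds_step)
    have XY: "L_XY C (S - {r}) (snd r) (fst r)
          \<le> prob (outcome_event (S - {r}) \<inter> observed_event (snd r) (fst r)) \<and>
        prob (outcome_event (S - {r}) \<inter> observed_event (snd r) (fst r))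
          \<le> U_XY C (S - {r}) (snd r) (fst r)" if r: "r \<in> S" for r
    proof (rule observed_bounds_step)
      show "admissible (S - {r})" by (rule admissible_remove[OF S True])
      \<comment> \<open>Distinct second components ensure that the index \<open>snd r\<close> does
        not occur in \<open>S - {r}\<close>.\<close>
      show "snd r \<in> {1..xnum C} - snd ` (S - {r})"
        using r sub inj by (auto dest: inj_onD)
      show "fst r \<in> {1..ynum C}" using r sub by auto
      fix t assume c: "card (S - {r}) \<ge> 2" "t \<in> S - {r}"
      show "L C (S - {r} - {t}) \<le> prob (outcome_event (S - {r} - {t})) \<and>
        prob (outcome_event (S - {r} - {t})) \<le> U C (S - {r} - {t})"
        using r c(2) admissible_remove[OF admissible_remove[OF S True] c(1), of t]
        by (intro IH) (auto simp: admissible_def)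
    qed
    note split = prob_outcome_event_eq_sum[OF S]
    have lsum: "(\<Sum>r\<in>S. L_XY C (S - {r}) (snd r) (fst r))
        + (\<Sum>p\<in>{1..xnum C} - snd ` S. L_X C S p) \<le> prob (outcome_event S)"
      unfolding split using X XY by (intro add_mono sum_mono) auto
    have usum: "prob (outcome_event S) \<le> (\<Sum>r\<in>S. U_XY C (S - {r}) (snd r) (fst r))
        + (\<Sum>p\<in>{1..xnum C} - snd ` S. U_X C S p)"
      unfolding split using X XY by (intro add_mono sum_mono) auto
    have space: "outcome_event T \<inter> space (law C) = outcome_event T" for T
      by (auto simp: outcome_event_def)
    have P_out: "P_out C t = prob (outcome_event {t} \<inter> space (law C))" for t
      by (simp add: P_out_eq space)
    \<comment> \<open>Taking the whole sample space for \<open>A\<close>, of probability 1, turns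
      \<open>- card S\<close> into \<open>- card S + 1\<close>. The bound for a single condition is
      then \<open>P_out\<close> itself, written with \<open>the_elem\<close> because
      \<open>l1\<close> and \<open>u1\<close> take sets.\<close>
    have l: "Max {0, (\<Sum>t\<in>S. P_out C t) + prob (space (law C)) - real (card S),
        (MAX t\<in>S. L C (S - {t}) + P_out C (the_elem {t}) - 1)} \<le> prob (outcome_event S)"
      using joint_lower_bound[OF S True sets.top, of "L C" "\<lambda>T. P_out C (the_elem T)"] IH1 P_out
      by (simp add: space)
    have u: "prob (outcome_event S) \<le> Min {MIN t\<in>S. P_out C t, prob (space (law C)),
        MIN t\<in>S. U C (S - {t}), MIN t\<in>S. P_out C (the_elem {t})}"
      using joint_upper_bound[OF S True sets.top, of "U C" "\<lambda>T. P_out C (the_elem T)"] IH1 P_out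
      by (simp add: space)
    have "L C S \<le> prob (outcome_event S)"
      using l lsum True fin ne by (simp add: L.simps[of C S] prob_space)
    moreover have "prob (outcome_event S) \<le> U C S"
      using u usum True fin ne by (simp add: U.simps[of C S])
    ultimately show ?thesis ..
  qed
qed

lemma treatment_bounds:
  assumes "admissible S" "p \<in> {1..xnum C} - snd ` S"
  shows "L_X C S p \<le> prob (outcome_event S \<inter> treatment_event p)"
    and "prob (outcome_event S \<inter> treatment_event p) \<le> U_X C S p"
  using treatment_bounds_step[OF assms] outcome_bounds[OF admissible_remove[OF assms(1)]] by auto

end

section \<open>From sets of pairs to indexed families\<close>

theorem theorem9:
  fixes C :: "('w, 'x, 'y) causal_model"
    and i j :: "nat \<Rightarrow> nat" and k p :: nat
    and S :: "(nat \<times> nat) set"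
  assumes "causal_model C"
    and "k \<ge> 2"
    and "\<And>t. t \<in> {1..k} \<Longrightarrow> i t \<in> {1..ynum C}"
    and "\<And>t. t \<in> {1..k} \<Longrightarrow> j t \<in> {1..xnum C}"
    and "inj_on j {1..k}"
    and "p \<in> {1..xnum C}" and "p \<notin> j ` {1..k}"
    and S_def: "S = (\<lambda>t. (i t, j t)) ` {1..k}"
  shows "Max {0,
           (\<Sum>t=1..k. \<P>(\<omega> in law C. outcome C (xval C (j t)) \<omega> = yval C (i t)))
             + \<P>(\<omega> in law C. treatment C \<omega> = xval C p) - real k,
           (MAX t\<in>{1..k}. L C (S - {(i t, j t)}) + L_X C {(i t, j t)} p - 1)}
         \<le> \<P>(\<omega> in law C. (\<forall>t\<in>{1..k}. outcome C (xval C (j t)) \<omega> = yval C (i t))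
              \<and> treatment C \<omega> = xval C p)
       \<and> \<P>(\<omega> in law C. (\<forall>t\<in>{1..k}. outcome C (xval C (j t)) \<omega> = yval C (i t))
              \<and> treatment C \<omega> = xval C p)
         \<le> Min {
           (MIN t\<in>{1..k}. \<P>(\<omega> in law C. outcome C (xval C (j t)) \<omega> = yval C (i t))),
           \<P>(\<omega> in law C. treatment C \<omega> = xval C p),
           (MIN t\<in>{1..k}. U C (S - {(i t, j t)})),
           (MIN t\<in>{1..k}. U_X C {(i t, j t)} p)}"
proof -
  interpret causal_model C by fact
  let ?g = "\<lambda>t. (i t, j t)"
  \<comment> \<open>Distinct second components already make the pairs distinct, so \<open>S\<close>
    has exactly \<open>k\<close> elements.\<close>
  have inj: "inj_on ?g {1..k}"
    by (rule inj_on_imageI2[of snd]) (use assms(5) in \<open>simp add: comp_def\<close>)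
  have card: "card S = k"
    unfolding S_def card_image[OF inj] by simp
  then have two: "\<not> card S < 2"
    using assms(2) by simp
  have snd: "snd ` S = j ` {1..k}"
    by (simp add: S_def image_image)
  have "inj_on snd S"
    unfolding S_def by (rule inj_on_imageI) (use assms(5) in \<open>simp add: comp_def\<close>)
  moreover have "S \<subseteq> {1..ynum C} \<times> {1..xnum C}" "S \<noteq> {}"
    using assms(2,3,4) by (auto simp: S_def)
  ultimately have S: "admissible S"
    by (simp add: admissible_def)
  have p: "p \<in> {1..xnum C} - snd ` S"
    using assms(6,7) snd by simp
  \<comment> \<open>Maxima and minima depend only on the image of \<open>S\<close>, so equality of
    images suffices for them. The sum counts each index and is reindexed by
    \<open>inj\<close>.\<close>
  have reindex: "f ` S = (\<lambda>t. f (?g t)) ` {1..k}" for f :: "nat \<times> nat \<Rightarrow> real"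
    by (simp add: S_def image_image)
  have sum: "(\<Sum>t\<in>S. P_out C t) = (\<Sum>t=1..k. P_out C (?g t))"
    unfolding S_def sum.reindex[OF inj] by simp
  have ev: "outcome_event S \<inter> treatment_event p =
      {\<omega> \<in> space (law C). (\<forall>t\<in>{1..k}. outcome C (xval C (j t)) \<omega> = yval C (i t))
        \<and> treatment C \<omega> = xval C p}"
    by (auto simp: outcome_event_def treatment_event_def S_def)
  have P_out: "P_out C (?g t) = \<P>(\<omega> in law C. outcome C (xval C (j t)) \<omega> = yval C (i t))" for t
    by (simp add: P_out_def)
  have L: "L_X C S p = Max {0, (\<Sum>t=1..k. P_out C (?g t)) + P_X C p - real k,
      MAX t\<in>{1..k}. L C (S - {?g t}) + L_X C {?g t} p - 1}"
    using two by (simp only: L_X.simps[of C S] if_False reindex sum) (simp only: card)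
  have U: "U_X C S p = Min {MIN t\<in>{1..k}. P_out C (?g t), P_X C p,
      MIN t\<in>{1..k}. U C (S - {?g t}), MIN t\<in>{1..k}. U_X C {?g t} p}"
    using two by (simp only: U_X.simps[of C S] if_False reindex)
  show ?thesis
    using treatment_bounds[OF S p] unfolding L U ev P_out P_X_def ..
qed

end
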